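(* (Reduction of order I.) Let $t_0\in\mathcal I$, and assume $x$ is a solution of $Lx=0$ on $\mathcal I$ with $x(t)\neq0$ for all $t\in\mathcal I$. Then $$y(t):=x(t)\int_{t_0}^{t}\frac{e_0^2(s,t_0)}{p(s)x^2(s)}\,d_\alpha s,\qquad t\in\mathcal I,$$ defines a second linearly independent solution $y$ of $Lx=0$ on $\mathcal I$ (that is, $y$ is a solution and $x,y$ are linearly independent).
   Context: $\mathcal I\subseteq\mathbb R$ is a nondegenerate interval. The functions $\kappa_0,\kappa_1:[0,1]\times\mathcal I\to[0,\infty)$ are continuous and satisfy, for all $t\in\mathcal I$: $\lim_{\alpha\to0^+}\kappa_1(\alpha,t)=1$, $\lim_{\alpha\to0^+}\kappa_0(\alpha,t)=0$, $\lim_{\alpha\to1^-}\kappa_1(\alpha,t)=0$, $\lim_{\alpha\to1^-}\kappa_0(\alpha,t)=1$, $\kappa_1(\alpha,t)\ne0$ for $\alpha\in[0,1)$, and $\kappa_0(\alpha,t)\neq0$ for $\alpha\in(0,1]$. Fix $\alpha\in(0,1]$ and write $\kappa_j(t)=\kappa_j(\alpha,t)$. The conformable (proportional) derivative is $D^{\alpha}f(t)=\kappa_1(t)f(t)+\kappa_0(t)f'(t)$. Write $d_\alpha s=ds/\kappa_0(s)$ and, for $t,s\in\mathcal I$, $e_0(t,s)=\exp\left(-\int_s^t\frac{\kappa_1(\tau)}{\kappa_0(\tau)}\,d\tau\right)$; $e_0^2(t,s)=(e_0(t,s))^2$. Let $p,q$ be continuous on $\mathcal I$ with $p(t)>0$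 for all $t\in\mathcal I$, and set $Lx=D^{\alpha}[pD^{\alpha}x]+qx$. $\mathbb D$ is the set of all continuous functions $x$ on $\mathcal I$ such that $D^{\alpha}x$ and $D^{\alpha}[pD^{\alpha}x]$ exist and are continuous on $\mathcal I$; a solution of $Lx=0$ on $\mathcal I$ is an $x\in\mathbb D$ with $Lx(t)=0$ for all $t\in\mathcal I$. *)

theory Defs
  imports "HOL-Analysis.Analysis"
begin

text \<open>
  Functions on the interval \<open>I\<close> are total functions \<open>real \<Rightarrow> real\<close> of which only the values on \<open>I\<close>
  matter. Derivatives are therefore taken within \<open>I\<close>, so they are one-sided at an endpoint of \<open>I\<close>
  that belongs to \<open>I\<close>.
\<close>

definition nondegenerate_interval :: "real set \<Rightarrow> bool" where
  "nondegenerate_interval I \<longleftrightarrow> is_interval I \<and> (\<exists>a\<in>I. \<exists>b\<in>I. a < b)"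

definition proportional_kernels ::
  "real set \<Rightarrow> (real \<Rightarrow> real \<Rightarrow> real) \<Rightarrow> (real \<Rightarrow> real \<Rightarrow> real) \<Rightarrow> bool" where
  "proportional_kernels I \<kappa>0 \<kappa>1 \<longleftrightarrow>
     (\<forall>\<alpha>\<in>{0..1}. \<forall>t\<in>I. 0 \<le> \<kappa>0 \<alpha> t \<and> 0 \<le> \<kappa>1 \<alpha> t) \<and>
     continuous_on ({0..1} \<times> I) (\<lambda>(\<alpha>, t). \<kappa>0 \<alpha> t) \<and>
     continuous_on ({0..1} \<times> I) (\<lambda>(\<alpha>, t). \<kappa>1 \<alpha> t) \<and>
     (\<forall>t\<in>I. ((\<lambda>\<alpha>. \<kappa>1 \<alpha> t) \<longlongrightarrow> 1) (at_right 0) \<and>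
            ((\<lambda>\<alpha>. \<kappa>0 \<alpha> t) \<longlongrightarrow> 0) (at_right 0) \<and>
            ((\<lambda>\<alpha>. \<kappa>1 \<alpha> t) \<longlongrightarrow> 0) (at_left 1) \<and>
            ((\<lambda>\<alpha>. \<kappa>0 \<alpha> t) \<longlongrightarrow> 1) (at_left 1) \<and>
            (\<forall>\<alpha>\<in>{0..<1}. \<kappa>1 \<alpha> t \<noteq> 0) \<and>
            (\<forall>\<alpha>\<in>{0<..1}. \<kappa>0 \<alpha> t \<noteq> 0))"

text \<open>
  From here on \<open>k0\<close> and \<open>k1\<close> stand for \<open>\<kappa>0 \<alpha>\<close> and \<open>\<kappa>1 \<alpha>\<close> with \<open>\<alpha> \<in> (0, 1]\<close> fixed. Since \<open>k0\<close> has no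
  zero on \<open>I\<close>, the derivative \<open>D\<^sup>\<alpha> f\<close> exists at \<open>t\<close> iff \<open>f\<close> is differentiable at \<open>t\<close>. Where this
  fails, the value of \<open>conf_deriv\<close> is meaningless, so existence is always demanded separately.
\<close>

definition conf_deriv ::
  "real set \<Rightarrow> (real \<Rightarrow> real) \<Rightarrow> (real \<Rightarrow> real) \<Rightarrow> (real \<Rightarrow> real) \<Rightarrow> real \<Rightarrow> real" where
  "conf_deriv I k0 k1 f t = k1 t * f t + k0 t * vector_derivative f (at t within I)"

definition conf_integral :: "(real \<Rightarrow> real) \<Rightarrow> real \<Rightarrow> real \<Rightarrow> (real \<Rightarrow> real) \<Rightarrow> real" where
  "conf_integral k0 a b f = (LBINT s=a..b. f s / k0 s)"

definition conf_exp0 ::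
  "(real \<Rightarrow> real) \<Rightarrow> (real \<Rightarrow> real) \<Rightarrow> real \<Rightarrow> real \<Rightarrow> real" where
  "conf_exp0 k0 k1 t s = exp (- (LBINT \<tau>=s..t. k1 \<tau> / k0 \<tau>))"

definition conf_domain ::
  "real set \<Rightarrow> (real \<Rightarrow> real) \<Rightarrow> (real \<Rightarrow> real) \<Rightarrow> (real \<Rightarrow> real) \<Rightarrow> (real \<Rightarrow> real) set" where
  "conf_domain I k0 k1 p =
     {x. continuous_on I x \<and>
         x differentiable_on I \<and>
         continuous_on I (conf_deriv I k0 k1 x) \<and>
         (\<lambda>t. p t * conf_deriv I k0 k1 x t) differentiable_on I \<and>
         continuous_on I (conf_deriv I k0 k1 (\<lambda>t. p t * conf_deriv I k0 k1 x t))}"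

definition conf_L ::
  "real set \<Rightarrow> (real \<Rightarrow> real) \<Rightarrow> (real \<Rightarrow> real) \<Rightarrow> (real \<Rightarrow> real) \<Rightarrow> (real \<Rightarrow> real) \<Rightarrow>
   (real \<Rightarrow> real) \<Rightarrow> real \<Rightarrow> real" where
  "conf_L I k0 k1 p q x t =
     conf_deriv I k0 k1 (\<lambda>t. p t * conf_deriv I k0 k1 x t) t + q t * x t"

definition conf_solution ::
  "real set \<Rightarrow> (real \<Rightarrow> real) \<Rightarrow> (real \<Rightarrow> real) \<Rightarrow> (real \<Rightarrow> real) \<Rightarrow> (real \<Rightarrow> real) \<Rightarrow>
   (real \<Rightarrow> real) \<Rightarrow> bool" where
  "conf_solution I k0 k1 p q x \<longleftrightarrow>
     x \<in> conf_domain I k0 k1 p \<and> (\<forall>t\<in>I. conf_L I k0 k1 p q x t = 0)"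

definition lin_indep_on :: "real set \<Rightarrow> (real \<Rightarrow> real) \<Rightarrow> (real \<Rightarrow> real) \<Rightarrow> bool" where
  "lin_indep_on I x y \<longleftrightarrow>
     (\<forall>a b. (\<forall>t\<in>I. a * x t + b * y t = 0) \<longrightarrow> a = 0 \<and> b = 0)"

end

theory Submission
  imports Defs
begin

text \<open>
  Write \<open>E t = e\<^sub>0(t, t\<^sub>0)\<close> and \<open>y = x H\<close>. Since \<open>H' = E\<^sup>2 / (\<kappa>\<^sub>0 p x\<^sup>2)\<close>, the product rule gives
  \<open>p D\<^sup>\<alpha>y = H (p D\<^sup>\<alpha>x) + E\<^sup>2 / x\<close>. As \<open>E' = - (\<kappa>\<^sub>1 / \<kappa>\<^sub>0) E\<close>, the terms that do not contain \<open>H\<close> cancel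
  on applying \<open>D\<^sup>\<alpha>\<close> once more, so \<open>D\<^sup>\<alpha>[p D\<^sup>\<alpha>y] = H D\<^sup>\<alpha>[p D\<^sup>\<alpha>x] = - q y\<close>. Independence holds because
  \<open>H\<close> vanishes at \<open>t\<^sub>0\<close> while \<open>H' > 0\<close> there.
\<close>

section \<open>Derivatives within a nondegenerate interval\<close>

text \<open>A connected set with more than one point has no isolated points. Limits within
  \<open>I\<close> are therefore unique, so \<open>vector_derivative\<close> returns the actual
  derivative wherever one exists, endpoints included.\<close>

lemma nondegenerate_interval_at_within_ne_bot:
  assumes "nondegenerate_interval I" "t \<in> I"
  shows "at t within I \<noteq> bot"
proof -
  obtain a b where "a \<in> I" "b \<in> I" "a < b" and "connected I"
    using assms(1) is_interval_connected by (auto simp: nondegenerate_interval_def)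
  then have "t islimpt I"
    using connected_imp_perfect[OF \<open>connected I\<close>] assms(2) by force
  then show ?thesis
    by (simp add: trivial_limit_within)
qed

lemma conf_deriv_eq:
  assumes "at t within I \<noteq> bot" "(f has_real_derivative f') (at t within I)"
  shows "conf_deriv I k0 k1 f t = k1 t * f t + k0 t * f'"
  using assms vector_derivative_within[of t I f f']
  by (simp add: conf_deriv_def has_real_derivative_iff_has_vector_derivative)

lemma differentiable_on_has_real_derivative:
  fixes f :: "real \<Rightarrow> real"
  assumes "f differentiable_on I" "t \<in> I"
  obtains f' where "(f has_real_derivative f') (at t within I)"
  using assms unfolding differentiable_on_def by (meson real_differentiable_def)

section \<open>Differentiation of integrals on an interval of any kind\<close>

text \<open>With its mirror image below, this yields a compact interval that is a neighbourhood of a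
  point relative to \<open>I\<close>, even at an endpoint. If \<open>I\<close> reaches beyond
  \<open>s\<close>, one such point serves as both \<open>d\<close> and \<open>e\<close>; otherwise
  \<open>s\<close> is the maximum of \<open>I\<close>, and \<open>d = s\<close> works with any
  larger \<open>e\<close>.\<close>

lemma greater_element_or_no_greater_near:
  fixes I :: "real set"
  assumes "s \<in> I"
  obtains d e where "d \<in> I" "s \<le> d" "s < e" "I \<inter> {..<e} \<subseteq> {..d}"
proof (cases "\<exists>d\<in>I. s < d")
  case True
  then obtain d where "d \<in> I" "s < d" by auto
  then show ?thesis by (intro that[of d d]) auto
next
  case False
  then show ?thesis using assms by (intro that[of s "s + 1"]) force+
qed

lemma less_element_or_no_less_near:
  fixes I :: "real set"
  assumes "s \<in> I"
  obtains d e where "d \<in> I" "d \<le> s" "e < s" "I \<inter> {e<..} \<subseteq> {d..}"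
proof (cases "\<exists>d\<in>I. d < s")
  case True
  then obtain d where "d \<in> I" "d < s" by auto
  then show ?thesis by (intro that[of d d]) auto
next
  case False
  then show ?thesis using assms by (intro that[of s "s - 1"]) force+
qed

text \<open>\<open>I\<close> may be open, half-open or unbounded. The fundamental theorem is applied
  on a compact \<open>{c..d}\<close> inside \<open>I\<close> that coincides with \<open>I\<close>
  near \<open>t\<close>; since differentiation is local, the result carries over to
  \<open>I\<close>.\<close>

lemma interval_integral_has_real_derivative:
  fixes f :: "real \<Rightarrow> real"
  assumes I: "is_interval I" and f: "continuous_on I f" and a: "a \<in> I" and t: "t \<in> I"
  shows "((\<lambda>u. LBINT s=a..u. f s) has_real_derivative f t) (at t within I)"
proof -
  \<comment> \<open>The minimum and maximum make \<open>{c..d}\<close> contain the base point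
    \<open>a\<close> as well as \<open>t\<close>, while \<open>c'\<close> and \<open>d'\<close> lie
    strictly on either side of \<open>t\<close>.\<close>
  have "max a t \<in> I" "min a t \<in> I"
    using a t by (auto simp: max_def min_def)
  then obtain c c' d d' where c: "c \<in> I" "c \<le> min a t" "c' < min a t" "I \<inter> {c'<..} \<subseteq> {c..}"
    and d: "d \<in> I" "max a t \<le> d" "max a t < d'" "I \<inter> {..<d'} \<subseteq> {..d}"
    by (metis greater_element_or_no_greater_near less_element_or_no_less_near)
  have cd: "{c..d} \<subseteq> I"
    using I c(1) d(1) by (meson atLeastAtMost_iff is_interval_1 subsetI)
  have "((\<lambda>u. LBINT s=a..u. f s) has_vector_derivative f t) (at t within {c..d})"
    using c d cd by (intro interval_integral_FTC2 continuous_on_subset[OF f]) auto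
  moreover have "at t within {c..d} = at t within I"
  proof (rule at_within_nhd)
    have "I \<inter> {c'<..<d'} = (I \<inter> {c'<..}) \<inter> (I \<inter> {..<d'})"
      by auto
    also have "\<dots> \<subseteq> {c..} \<inter> {..d}"
      by (rule Int_mono[OF c(4) d(4)])
    also have "\<dots> = {c..d}"
      by auto
    finally show "{c..d} \<inter> {c'<..<d'} - {t} = I \<inter> {c'<..<d'} - {t}"
      using cd by blast
    show "t \<in> {c'<..<d'}"
      using c(3) d(3) by simp
  qed simp
  ultimately show ?thesis
    by (simp add: has_real_derivative_iff_has_vector_derivative)
qed

section \<open>The exponential and the calculus of the proportional derivative\<close>

text \<open>The chain rule applied to the integral in the exponent. The formula amounts to
  \<open>k1 * E + k0 * E' = 0\<close>: the proportional derivative annihilates the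
  exponential.\<close>

lemma conf_exp0_has_real_derivative:
  assumes "is_interval I" "continuous_on I k0" "continuous_on I k1" "\<And>t. t \<in> I \<Longrightarrow> k0 t \<noteq> 0"
    and "s \<in> I" "t \<in> I"
  shows "((\<lambda>u. conf_exp0 k0 k1 u s) has_real_derivative - (k1 t / k0 t) * conf_exp0 k0 k1 t s)
           (at t within I)"
proof -
  have "continuous_on I (\<lambda>\<tau>. k1 \<tau> / k0 \<tau>)"
    using assms by (intro continuous_intros) auto
  from interval_integral_has_real_derivative[OF assms(1) this assms(5,6)] show ?thesis
    unfolding conf_exp0_def by (auto intro!: derivative_eq_intros)
qed

text \<open>The term \<open>k1 * f * g\<close> occurs only once; assigning it to \<open>f\<close>
  leaves just the ordinary derivative of \<open>g\<close>. This asymmetric form suits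
  \<open>g = H\<close>, whose ordinary derivative is explicit.\<close>

lemma conf_deriv_mult:
  assumes "at t within I \<noteq> bot" "f differentiable_on I" "t \<in> I"
    and "(g has_real_derivative g') (at t within I)"
  shows "conf_deriv I k0 k1 (\<lambda>u. f u * g u) t = conf_deriv I k0 k1 f t * g t + k0 t * f t * g'"
proof -
  obtain f' where f': "(f has_real_derivative f') (at t within I)"
    using differentiable_on_has_real_derivative[OF assms(2,3)] .
  show ?thesis
    using conf_deriv_eq[OF assms(1) f', of k0 k1]
      conf_deriv_eq[OF assms(1) DERIV_mult[OF f' assms(4)], of k0 k1]
    by (simp add: algebra_simps)
qed

text \<open>Both functions have the same candidates for a derivative within \<open>I\<close>, so the
  choice operator in \<open>vector_derivative\<close> picks the same value, even where no derivative
  exists. This matters because \<open>y\<close> is prescribed on \<open>I\<close> only.\<close>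

lemma conf_deriv_cong:
  assumes "t \<in> I" "\<And>u. u \<in> I \<Longrightarrow> f u = g u"
  shows "conf_deriv I k0 k1 f t = conf_deriv I k0 k1 g t"
proof -
  have "(f has_vector_derivative d) (at t within I) \<longleftrightarrow>
        (g has_vector_derivative d) (at t within I)" for d
    using assms has_vector_derivative_transform[of t I g f d]
      has_vector_derivative_transform[of t I f g d] by auto
  then show ?thesis
    using assms by (simp add: conf_deriv_def vector_derivative_def)
qed

section \<open>Reduction of order\<close>

text \<open>Only the differential equations for \<open>E\<close> and \<open>H\<close> enter, which
  keeps the computation free of integrals and of the base point.\<close>

lemma conf_solution_reduction_of_order:
  fixes p q x H k0 k1 E :: "real \<Rightarrow> real"
  assumes I: "nondegenerate_interval I"
    and p: "continuous_on I p" "\<And>t. t \<in> I \<Longrightarrow> p t \<noteq> 0"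
    and k0: "\<And>t. t \<in> I \<Longrightarrow> k0 t \<noteq> 0"
    and x: "conf_solution I k0 k1 p q x" "\<And>t. t \<in> I \<Longrightarrow> x t \<noteq> 0"
    and E: "\<And>t. t \<in> I \<Longrightarrow> (E has_real_derivative - (k1 t / k0 t) * E t) (at t within I)"
    and H: "\<And>t. t \<in> I \<Longrightarrow>
              (H has_real_derivative (E t)\<^sup>2 / (p t * (x t)\<^sup>2) / k0 t) (at t within I)"
    and y: "\<And>t. t \<in> I \<Longrightarrow> y t = x t * H t"
  shows "conf_solution I k0 k1 p q y"
proof -
  let ?D = "conf_deriv I k0 k1"
  have nb: "at t within I \<noteq> bot" if "t \<in> I" for t
    using nondegenerate_interval_at_within_ne_bot[OF I that] .
  have x_cont: "continuous_on I x" and x_diff: "x differentiable_on I"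
    and Dx_cont: "continuous_on I (?D x)"
    and pDx_diff: "(\<lambda>t. p t * ?D x t) differentiable_on I"
    and DpDx_cont: "continuous_on I (?D (\<lambda>t. p t * ?D x t))"
    and Lx: "\<And>t. t \<in> I \<Longrightarrow> ?D (\<lambda>t. p t * ?D x t) t + q t * x t = 0"
    using x(1) by (auto simp: conf_solution_def conf_domain_def conf_L_def)
  have H_cont: "continuous_on I H"
    using H by (rule DERIV_continuous_on)
  have E_cont: "continuous_on I E"
    using E by (rule DERIV_continuous_on)
  have H_diff: "H differentiable_on I"
    using H by (auto simp: differentiable_on_def real_differentiable_def)
  have y_cont: "continuous_on I y"
    using x_cont H_cont y by (simp cong: continuous_on_cong) (intro continuous_intros)
  have y_diff: "y differentiable_on I"
    unfolding differentiable_on_def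
  proof
    fix t assume t: "t \<in> I"
    then have "(\<lambda>t. x t * H t) differentiable (at t within I)"
      using differentiable_on_mult[OF x_diff H_diff] by (simp add: differentiable_on_def)
    \<comment> \<open>Any radius would do in place of 1, since \<open>y\<close> and the product
      agree on all of \<open>I\<close>.\<close>
    then show "y differentiable (at t within I)"
      by (rule differentiable_transform_within[OF _ zero_less_one t]) (simp add: y)
  qed
  have Dy: "?D y t = ?D x t * H t + (E t)\<^sup>2 / (p t * x t)" if t: "t \<in> I" for t
  proof -
    have "?D y t = ?D x t * H t + k0 t * x t * ((E t)\<^sup>2 / (p t * (x t)\<^sup>2) / k0 t)"
      unfolding conf_deriv_mult[OF nb[OF t] x_diff t H[OF t], symmetric]
      by (rule conf_deriv_cong[OF t]) (simp add: y)
    then show ?thesis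
      using x(2)[OF t] k0[OF t] by (simp add: power2_eq_square)
  qed
  have Dy_cont: "continuous_on I (?D y)"
  proof -
    have "continuous_on I (\<lambda>t. ?D x t * H t + (E t)\<^sup>2 / (p t * x t))"
      using Dx_cont H_cont E_cont p x_cont x(2) by (intro continuous_intros) auto
    then show ?thesis
      using Dy by (simp cong: continuous_on_cong)
  qed
  \<comment> \<open>As \<open>p\<close> is merely continuous, \<open>p t * ?D x t\<close> has to
    stay together as one differentiable factor of \<open>G\<close>; in the remainder
    \<open>R\<close> the factor \<open>p\<close> has cancelled.\<close>
  define G where "G t = (p t * ?D x t) * H t" for t
  define R where "R t = (E t)\<^sup>2 / x t" for t
  have pDy: "p t * ?D y t = G t + R t" if "t \<in> I" for t
    using Dy[OF that] p(2)[OF that] by (simp add: algebra_simps G_def R_def)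
  \<comment> \<open>\<open>R'\<close> is the quotient rule for \<open>R\<close> with the equation
    for \<open>E'\<close> inserted; the factor 2 comes from the square of \<open>E\<close>.\<close>
  have deriv: "((\<lambda>t. p t * ?D y t) has_real_derivative G' + R') (at t within I)
                 \<and> ?D (\<lambda>t. p t * ?D y t) t = ?D (\<lambda>t. p t * ?D x t) t * H t"
    if t: "t \<in> I" and x': "(x has_real_derivative x') (at t within I)"
      and G': "(G has_real_derivative G') (at t within I)"
      and R'_def: "R' = - 2 * (k1 t / k0 t) * (E t)\<^sup>2 / x t - (E t)\<^sup>2 * x' / (x t)\<^sup>2"
    for t x' G' R'
  proof
    have R': "(R has_real_derivative R') (at t within I)"
      unfolding R_def R'_def using x(2)[OF t]
      by (intro DERIV_cong[OF DERIV_divide[OF DERIV_power[OF E[OF t]] x']])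
        (simp_all add: power2_eq_square diff_divide_distrib)
    show "((\<lambda>t. p t * ?D y t) has_real_derivative G' + R') (at t within I)"
      using DERIV_add[OF G' R'] unfolding has_real_derivative_iff_has_vector_derivative
      by (rule has_vector_derivative_transform[OF t, rotated]) (simp add: pDy)
    have "?D (\<lambda>t. p t * ?D y t) t = ?D (\<lambda>t. G t + R t) t"
      by (rule conf_deriv_cong[OF t]) (simp add: pDy)
    also have "\<dots> = ?D G t + ?D R t"
      using conf_deriv_eq[OF nb[OF t] DERIV_add[OF G' R'], of k0 k1]
        conf_deriv_eq[OF nb[OF t] G', of k0 k1] conf_deriv_eq[OF nb[OF t] R', of k0 k1]
      by (simp add: algebra_simps)
    also have "?D G t = ?D (\<lambda>t. p t * ?D x t) t * H t
                          + k0 t * (p t * ?D x t) * ((E t)\<^sup>2 / (p t * (x t)\<^sup>2) / k0 t)"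
      unfolding G_def by (rule conf_deriv_mult[OF nb[OF t] pDx_diff t H[OF t]])
    also have "k0 t * (p t * ?D x t) * ((E t)\<^sup>2 / (p t * (x t)\<^sup>2) / k0 t)
                 = ?D x t * (E t)\<^sup>2 / (x t)\<^sup>2"
      using p(2)[OF t] k0[OF t] by simp
    also have "?D x t = k1 t * x t + k0 t * x'"
      using conf_deriv_eq[OF nb[OF t] x'] .
    also have "?D R t = k1 t * R t + k0 t * R'"
      using conf_deriv_eq[OF nb[OF t] R'] .
    also have "k0 t * R' = - 2 * k1 t * (E t)\<^sup>2 / x t - k0 t * (E t)\<^sup>2 * x' / (x t)\<^sup>2"
      using k0[OF t] by (simp add: R'_def right_diff_distrib)
    also have "(k1 t * x t + k0 t * x') * (E t)\<^sup>2 / (x t)\<^sup>2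
                 = k1 t * (E t)\<^sup>2 / x t + k0 t * (E t)\<^sup>2 * x' / (x t)\<^sup>2"
      using x(2)[OF t] by (simp add: distrib_right add_divide_distrib power2_eq_square)
    \<comment> \<open>The term \<open>- 2 * k1 t * (E t)\<^sup>2 / x t\<close> is balanced by one
      copy from \<open>?D x t\<close> and one from \<open>k1 t * R t\<close>; the two terms with
      \<open>x'\<close> cancel each other.\<close>
    finally show "?D (\<lambda>t. p t * ?D y t) t = ?D (\<lambda>t. p t * ?D x t) t * H t"
      by (simp add: R_def)
  qed
  have pDy_diff: "(\<lambda>t. p t * ?D y t) differentiable_on I"
    and DpDy: "\<And>t. t \<in> I \<Longrightarrow> ?D (\<lambda>t. p t * ?D y t) t = ?D (\<lambda>t. p t * ?D x t) t * H t"
  proof -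
    have G_diff: "G differentiable_on I"
      unfolding G_def using differentiable_on_mult[OF pDx_diff H_diff] .
    have *: "(\<exists>d. ((\<lambda>t. p t * ?D y t) has_real_derivative d) (at t within I))
             \<and> ?D (\<lambda>t. p t * ?D y t) t = ?D (\<lambda>t. p t * ?D x t) t * H t" if t: "t \<in> I" for t
    proof -
      obtain x' G' where x': "(x has_real_derivative x') (at t within I)"
        and G': "(G has_real_derivative G') (at t within I)"
        using differentiable_on_has_real_derivative[OF x_diff t]
          differentiable_on_has_real_derivative[OF G_diff t] by metis
      from deriv[OF t x' G' refl] show ?thesis
        by blast
    qed
    show "(\<lambda>t. p t * ?D y t) differentiable_on I"
      unfolding differentiable_on_def real_differentiable_def using * by blast
    show "?D (\<lambda>t. p t * ?D y t) t = ?D (\<lambda>t. p t * ?D x t) t * H t" if "t \<in> I" for t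
      using *[OF that] by blast
  qed
  have "continuous_on I (?D (\<lambda>t. p t * ?D y t))"
    using continuous_on_mult[OF DpDx_cont H_cont] DpDy by (simp cong: continuous_on_cong)
  moreover have "?D (\<lambda>t. p t * ?D y t) t + q t * y t = 0" if t: "t \<in> I" for t
  proof -
    have "?D (\<lambda>t. p t * ?D y t) t + q t * y t = (?D (\<lambda>t. p t * ?D x t) t + q t * x t) * H t"
      using DpDy[OF t] y[OF t] by (simp add: algebra_simps)
    then show ?thesis
      using Lx[OF t] by simp
  qed
  ultimately show ?thesis
    using y_cont y_diff Dy_cont pDy_diff
    by (auto simp: conf_solution_def conf_domain_def conf_L_def)
qed

section \<open>Linear independence\<close>

text \<open>At \<open>t0\<close> a linear relation reduces to \<open>a * x t0 = 0\<close>. With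
  \<open>a = 0\<close> and \<open>b\<close> nonzero, \<open>H\<close> would vanish on
  \<open>I\<close>, and uniqueness of the derivative at \<open>t0\<close> would give
  \<open>H' = 0\<close>.\<close>

lemma lin_indep_on_mult:
  fixes x H :: "real \<Rightarrow> real"
  assumes "at t0 within I \<noteq> bot" "t0 \<in> I" "\<And>t. t \<in> I \<Longrightarrow> x t \<noteq> 0"
    and H: "H t0 = 0" "(H has_real_derivative H') (at t0 within I)" "H' \<noteq> 0"
    and y: "\<And>t. t \<in> I \<Longrightarrow> y t = x t * H t"
  shows "lin_indep_on I x y"
  unfolding lin_indep_on_def
proof (intro allI impI)
  fix a b assume ab: "\<forall>t\<in>I. a * x t + b * y t = 0"
  then have "a = 0"
    using assms(2,3) H(1) y by force
  moreover have "b = 0"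
  proof (rule ccontr)
    assume "b \<noteq> 0"
    then have "H t = 0" if "t \<in> I" for t
      using ab that assms(3)[OF that] y[OF that] \<open>a = 0\<close> by force
    then have "((\<lambda>_. 0) has_vector_derivative H') (at t0 within I)"
      using H(2) assms(2) has_vector_derivative_transform[of t0 I "\<lambda>_. 0" H H']
      by (simp add: has_real_derivative_iff_has_vector_derivative)
    then have "H' = 0"
      using vector_derivative_unique_within[OF assms(1)] has_vector_derivative_const by blast
    then show False using H(3) by simp
  qed
  ultimately show "a = 0 \<and> b = 0" by simp
qed

section \<open>Kernels at a fixed \<alpha>, and the concrete integrals\<close>

lemma proportional_kernels_continuous_on:
  assumes "proportional_kernels I \<kappa>0 \<kappa>1" "\<alpha> \<in> {0..1}"
  shows "continuous_on I (\<kappa>0 \<alpha>)" "continuous_on I (\<kappa>1 \<alpha>)"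
proof -
  have *: "continuous_on I (\<lambda>t. (\<alpha>, t))" "(\<lambda>t. (\<alpha>, t)) ` I \<subseteq> {0..1} \<times> I"
    using assms(2) by (auto intro: continuous_intros)
  show "continuous_on I (\<kappa>0 \<alpha>)" "continuous_on I (\<kappa>1 \<alpha>)"
    using assms(1) continuous_on_compose2[OF _ *, of "\<lambda>(\<alpha>, t). \<kappa>0 \<alpha> t"]
      continuous_on_compose2[OF _ *, of "\<lambda>(\<alpha>, t). \<kappa>1 \<alpha> t"]
    by (auto simp: proportional_kernels_def)
qed

theorem theorem4p1:
  fixes I :: "real set"
    and \<kappa>0 \<kappa>1 :: "real \<Rightarrow> real \<Rightarrow> real"
    and \<alpha> t0 :: real
    and p q x y :: "real \<Rightarrow> real"
  assumes "nondegenerate_interval I"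
    and "proportional_kernels I \<kappa>0 \<kappa>1"
    and "\<alpha> \<in> {0<..1}"
    and "continuous_on I p" and "\<And>t. t \<in> I \<Longrightarrow> p t > 0"
    and "continuous_on I q"
    and "t0 \<in> I"
    and "conf_solution I (\<kappa>0 \<alpha>) (\<kappa>1 \<alpha>) p q x"
    and "\<And>t. t \<in> I \<Longrightarrow> x t \<noteq> 0"
    and "\<And>t. t \<in> I \<Longrightarrow>
           y t = x t * conf_integral (\<kappa>0 \<alpha>) t0 t
                         (\<lambda>s. (conf_exp0 (\<kappa>0 \<alpha>) (\<kappa>1 \<alpha>) s t0)\<^sup>2 / (p s * (x s)\<^sup>2))"
  shows "conf_solution I (\<kappa>0 \<alpha>) (\<kappa>1 \<alpha>) p q y \<and> lin_indep_on I x y"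
proof -
  have I: "is_interval I"
    using assms(1) by (simp add: nondegenerate_interval_def)
  \<comment> \<open>Here \<alpha> > 0 is essential: at \<alpha> = 0, continuity and the limit
    condition force \<open>\<kappa>0\<close> to be zero.\<close>
  have k0: "\<And>t. t \<in> I \<Longrightarrow> \<kappa>0 \<alpha> t \<noteq> 0"
    using assms(2,3) by (auto simp: proportional_kernels_def)
  have cont: "continuous_on I (\<kappa>0 \<alpha>)" "continuous_on I (\<kappa>1 \<alpha>)"
    using proportional_kernels_continuous_on[OF assms(2), of \<alpha>] assms(3) by auto
  have x_cont: "continuous_on I x"
    using assms(8) by (simp add: conf_solution_def conf_domain_def)
  define E where "E s = conf_exp0 (\<kappa>0 \<alpha>) (\<kappa>1 \<alpha>) s t0" for s
  define H where "H t = conf_integral (\<kappa>0 \<alpha>) t0 t (\<lambda>s. (E s)\<^sup>2 / (p s * (x s)\<^sup>2))" for t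
  have E: "(E has_real_derivative - (\<kappa>1 \<alpha> t / \<kappa>0 \<alpha> t) * E t) (at t within I)" if "t \<in> I" for t
    unfolding E_def by (rule conf_exp0_has_real_derivative[OF I cont k0 assms(7) that])
  then have "continuous_on I E"
    by (rule DERIV_continuous_on)
  then have "continuous_on I (\<lambda>s. (E s)\<^sup>2 / (p s * (x s)\<^sup>2) / \<kappa>0 \<alpha> s)"
    using assms(4) x_cont cont k0 assms(9) assms(5)[THEN less_imp_neq]
    by (intro continuous_intros) force+
  then have H: "(H has_real_derivative (E t)\<^sup>2 / (p t * (x t)\<^sup>2) / \<kappa>0 \<alpha> t) (at t within I)"
    if "t \<in> I" for t
    unfolding H_def conf_integral_def
    by (rule interval_integral_has_real_derivative[OF I _ assms(7) that])
  have p: "\<And>t. t \<in> I \<Longrightarrow> p t \<noteq> 0"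
    using assms(5) by force
  have y: "\<And>t. t \<in> I \<Longrightarrow> y t = x t * H t"
    using assms(10) by (simp add: H_def E_def)
  \<comment> \<open>This is the derivative of \<open>H\<close> at \<open>t0\<close>; its numerator
    is nonzero because \<open>E\<close> is an exponential.\<close>
  have "(E t0)\<^sup>2 / (p t0 * (x t0)\<^sup>2) / \<kappa>0 \<alpha> t0 \<noteq> 0"
    using assms(7,9) k0 p by (simp add: E_def conf_exp0_def)
  moreover have "H t0 = 0"
    by (simp add: H_def conf_integral_def)
  ultimately have "lin_indep_on I x y"
    using lin_indep_on_mult[OF nondegenerate_interval_at_within_ne_bot[OF assms(1,7)] assms(7,9)
        _ H[OF assms(7)] _ y] by blast
  with conf_solution_reduction_of_order[OF assms(1,4) p k0 assms(8,9) E H y] show ?thesis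
    by blast
qed

end
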